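(* Let $f:[0,\pi)\to\mathbb{R}$ be defined by $f(0)=\frac{3}{8}$ and $$f(x)=\frac{1-\dfrac{\cos x}{\cos\frac{x}{2}}}{x^2},\qquad x\in(0,\pi).$$ Let $c\in(0,\pi)$. Then for every $x\in(0,c)$ and all $m,n\in\mathbb{N}_0$, $$\frac{3}{8}=T_0^{f,0+}(x)\le T_2^{f,0+}(x)\le\cdots\le T_{2n}^{f,0+}(x)\le T_{2n+2}^{f,0+}(x)\le\cdots\le f(x)$$ and $$f(x)\le\cdots\le\mathbb{T}_{2m+2}^{f;0+,c-}(x)\le\mathbb{T}_{2m}^{f;0+,c-}(x)\le\cdots\le\mathbb{T}_2^{f;0+,c-}(x)\le\mathbb{T}_0^{f;0+,c-}(x)=\frac{1-\dfrac{\cos c}{\cos\frac{c}{2}}}{c^2}.$$ That is, the first Taylor approximations of even order are nondecreasing in the order and bounded above by $f(x)$, and the second Taylor approximations of even order are nonincreasing in the order and bounded below by $f(x)$.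
   Context: $\mathbb{N}_0=\{0,1,2,\dots\}$. For a real function $h$ on $(a,b)$ such that the finite one-sided limits $h^{(k)}(a+)=\lim_{x\to a+}h^{(k)}(x)$ exist for $k=0,1,\dots,n$, the first Taylor approximation of $h$ of order $n$ in the right neighborhood of $a$ is $$T_n^{h,a+}(x)=\sum_{k=0}^n\frac{h^{(k)}(a+)}{k!}(x-a)^k .$$ For $n\ge1$ let $R_n^{h,a+}(x)=h(x)-T_{n-1}^{h,a+}(x)$. If the left limit $h(b-)=\lim_{x\to b-}h(x)$ exists and is finite, write $R_n^{h,a+}(b-)=h(b-)-T_{n-1}^{h,a+}(b)$. The second Taylor approximation of $h$ of order $n$ in the right neighborhood of $a$ is $$\mathbb{T}_n^{h;a+,b-}(x)=T_{n-1}^{h,a+}(x)+\frac{R_n^{h,a+}(b-)}{(b-a)^n}(x-a)^n\quad(n\ge1),\qquad \mathbb{T}_0^{h;a+,b-}(x)=h(b-).$$ Here these are used with $h=f$, $a=0$, $b=c$. *)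

theory Defs
  imports "HOL-Analysis.Analysis"
begin

text \<open>The iterate \<open>(deriv ^^ k) h\<close> at a point of the open interval \<open>(a, b)\<close> depends only on \<open>h\<close>
  near that point, so the values of the total function \<open>h\<close> outside \<open>(a, b)\<close> play no role below.\<close>

definition deriv_right :: "(real \<Rightarrow> real) \<Rightarrow> real \<Rightarrow> nat \<Rightarrow> real"
  where "deriv_right h a k = Lim (at_right a) ((deriv ^^ k) h)"

text \<open>Both \<open>deriv\<close> and \<open>Lim\<close> are total; the next predicate says that \<open>h\<close> really has derivatives up
  to order \<open>n\<close> on \<open>(a, b)\<close>, all with finite right limits at \<open>a\<close>.\<close>

definition right_taylor_data :: "(real \<Rightarrow> real) \<Rightarrow> real \<Rightarrow> real \<Rightarrow> nat \<Rightarrow> bool"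
  where "right_taylor_data h a b n \<longleftrightarrow>
    (\<forall>k<n. \<forall>x\<in>{a<..<b}. (deriv ^^ k) h differentiable (at x)) \<and>
    (\<forall>k\<le>n. \<exists>l. ((deriv ^^ k) h \<longlongrightarrow> l) (at_right a))"

definition taylor1 :: "nat \<Rightarrow> (real \<Rightarrow> real) \<Rightarrow> real \<Rightarrow> real \<Rightarrow> real"
  where "taylor1 n h a x = (\<Sum>k\<le>n. deriv_right h a k / fact k * (x - a) ^ k)"

text \<open>The value \<open>R_n(b-)\<close> of the remainder; meaningful for \<open>n \<ge> 1\<close> only.\<close>

definition remainder_left :: "nat \<Rightarrow> (real \<Rightarrow> real) \<Rightarrow> real \<Rightarrow> real \<Rightarrow> real"
  where "remainder_left n h a b = Lim (at_left b) h - taylor1 (n - 1) h a b"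

definition taylor2 :: "nat \<Rightarrow> (real \<Rightarrow> real) \<Rightarrow> real \<Rightarrow> real \<Rightarrow> real \<Rightarrow> real"
  where "taylor2 n h a b x =
    (if n = 0 then Lim (at_left b) h
     else taylor1 (n - 1) h a x + remainder_left n h a b / (b - a) ^ n * (x - a) ^ n)"

end

theory Submission
  imports Defs "HOL-Complex_Analysis.Cauchy_Integral_Formula"
begin

text \<open>Putting \<open>cos x = 2 (cos (x/2))\<^sup>2 - 1\<close> turns the numerator of \<open>f\<close> into
  \<open>1 - 2 cos (x/2) + 1 / cos (x/2)\<close>. The secant numbers \<open>1, 1, 5, 61, \<dots>\<close> are at least \<open>3\<close> from the
  third one on and so outweigh the coefficients of \<open>2 cos\<close>; hence \<open>f\<close> is a power series with
  nonnegative coefficients that converges on \<open>(-\<pi>, \<pi>)\<close>. For such a series \<open>\<Sum>a\<^sub>k x\<^sup>k\<close> the first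
  Taylor approximations are partial sums, and the second ones replace the tail
  \<open>\<Sum>\<^bsub>k\<ge>n\<^esub> a\<^sub>k x\<^sup>k\<close> by \<open>\<Sum>\<^bsub>k\<ge>n\<^esub> a\<^sub>k c\<^sup>k (x/c)\<^sup>n\<close>, which is larger term by term as \<open>x < c\<close>.\<close>

section \<open>Taylor approximations of power series\<close>

lemma fps_conv_radius_nth_deriv:
  fixes F :: "'a :: {banach, real_normed_field} fps"
  shows "fps_conv_radius (fps_nth_deriv k F) \<ge> fps_conv_radius F"
proof (induction k arbitrary: F)
  case (Suc k)
  show ?case
    using order_trans[OF fps_conv_radius_deriv Suc.IH] by simp
qed simp

lemma has_field_derivative_eval_fps_nth_deriv:
  fixes F :: "'a :: {banach, real_normed_field} fps"
  assumes "ereal (norm x) < fps_conv_radius F"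
  shows "(eval_fps (fps_nth_deriv k F) has_field_derivative
           eval_fps (fps_nth_deriv (Suc k) F) x) (at x)"
  using has_field_derivative_eval_fps[OF less_le_trans[OF assms fps_conv_radius_nth_deriv[of F k]]]
  by (simp only: fps_nth_deriv_commute)

lemma norm_less_fps_conv_radius:
  fixes x :: real
  shows "ereal r \<le> fps_conv_radius F \<Longrightarrow> \<bar>x\<bar> < r \<Longrightarrow> ereal (norm x) < fps_conv_radius F"
  by (metis less_ereal.simps(1) order_less_le_trans real_norm_def)

context
  fixes F :: "real fps" and f :: "real \<Rightarrow> real" and r :: real
  assumes r: "0 < r" "ereal r \<le> fps_conv_radius F"
    and f: "\<forall>x\<in>{0<..<r}. f x = eval_fps F x"
begin

text \<open>A derivative at \<open>x\<close> sees only values near \<open>x\<close>, and the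
  interval is open. Taking an arbitrary \<open>g\<close> lets this serve \<open>f\<close> and, in
  the induction that follows, each of its iterated derivatives.\<close>

lemma has_field_derivative_transfer:
  assumes "x \<in> {0<..<r}" and g: "\<And>y. y \<in> {0<..<r} \<Longrightarrow> g y = eval_fps (fps_nth_deriv k F) y"
  shows "(g has_field_derivative eval_fps (fps_nth_deriv (Suc k) F) x) (at x)"
proof (rule has_field_derivative_transform_within_open
         [OF has_field_derivative_eval_fps_nth_deriv open_greaterThanLessThan assms(1)])
  show "ereal (norm x) < fps_conv_radius F"
    using assms(1) by (intro norm_less_fps_conv_radius[OF r(2)]) auto
qed (simp add: g)

lemma higher_deriv_eq_eval_fps:
  "x \<in> {0<..<r} \<Longrightarrow> (deriv ^^ k) f x = eval_fps (fps_nth_deriv k F) x"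
proof (induction k arbitrary: x)
  case (Suc k)
  show ?case
    using DERIV_imp_deriv[OF has_field_derivative_transfer[OF Suc.prems Suc.IH]] by simp
qed (simp add: f)

lemma higher_deriv_differentiable:
  "x \<in> {0<..<r} \<Longrightarrow> (deriv ^^ k) f differentiable (at x)"
  using has_field_derivative_transfer higher_deriv_eq_eval_fps
  unfolding real_differentiable_def by blast

text \<open>\<open>f\<close> is tied to the series only on the right of 0, so the limit is read off
  from the differentiated series, which is continuous at 0 itself.\<close>

lemma higher_deriv_tendsto_at_right_0:
  "((deriv ^^ k) f \<longlongrightarrow> fact k * fps_nth F k) (at_right 0)"
proof -
  have "isCont (eval_fps (fps_nth_deriv k F)) 0"
    by (rule DERIV_isCont[OF has_field_derivative_eval_fps_nth_deriv
          [OF norm_less_fps_conv_radius[OF r(2)]]]) (use r(1) in simp)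
  then have "(eval_fps (fps_nth_deriv k F) \<longlongrightarrow> eval_fps (fps_nth_deriv k F) 0) (at_right 0)"
    by (simp add: continuous_at_imp_continuous_at_within flip: continuous_within)
  moreover have "\<forall>\<^sub>F x in at_right 0. eval_fps (fps_nth_deriv k F) x = (deriv ^^ k) f x"
    using eventually_at_right_real[OF r(1)] by eventually_elim (simp add: higher_deriv_eq_eval_fps)
  moreover have "eval_fps (fps_nth_deriv k F) 0 = fact k * fps_nth F k"
    by (simp add: eval_fps_at_0 fps_deriv_maclauren_0)
  ultimately show ?thesis
    by (simp add: Lim_transform_eventually)
qed

lemma right_taylor_data_fps: "c \<le> r \<Longrightarrow> right_taylor_data f 0 c n"
  unfolding right_taylor_data_def
  by (intro conjI allI impI ballI exI, rule higher_deriv_differentiable)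
     (auto intro: higher_deriv_tendsto_at_right_0)

lemma taylor1_fps: "taylor1 n f 0 x = (\<Sum>k\<le>n. fps_nth F k * x ^ k)"
  unfolding taylor1_def deriv_right_def
  by (simp add: tendsto_Lim[OF _ higher_deriv_tendsto_at_right_0])

lemma tendsto_at_left_fps:
  assumes "c \<in> {0<..<r}"
  shows "(f \<longlongrightarrow> f c) (at_left c)"
proof -
  have "isCont f c"
    using has_field_derivative_transfer[where k = 0, OF assms, of f] f
    by (intro DERIV_isCont) auto
  then show ?thesis
    by (simp add: continuous_at_imp_continuous_at_within flip: continuous_within)
qed

lemma sums_fps: "x \<in> {0<..<r} \<Longrightarrow> (\<lambda>k. fps_nth F k * x ^ k) sums f x"
  using sums_eval_fps[OF norm_less_fps_conv_radius[OF r(2)]] f by fastforce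

text \<open>Summing over \<open>k < n\<close> rather than up to \<open>n - 1\<close> brings order 0
  under the same formula: the sums are empty and the left limit \<open>f c\<close> remains.\<close>

lemma taylor2_fps:
  assumes "c \<in> {0<..<r}"
  shows "taylor2 n f 0 c x = (\<Sum>k<n. fps_nth F k * x ^ k) +
    (f c - (\<Sum>k<n. fps_nth F k * c ^ k)) * (x / c) ^ n"
proof (cases n)
  case 0
  then show ?thesis
    by (simp add: taylor2_def tendsto_Lim[OF _ tendsto_at_left_fps[OF assms]])
next
  case (Suc m)
  then show ?thesis
    by (simp add: taylor2_def remainder_left_def taylor1_fps lessThan_Suc_atMost power_divide
        tendsto_Lim[OF _ tendsto_at_left_fps[OF assms]])
qed

context
  assumes nonneg: "\<And>k. fps_nth F k \<ge> 0"
begin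

lemma partial_sum_le_fps:
  "x \<in> {0<..<r} \<Longrightarrow> (\<Sum>k<n. fps_nth F k * x ^ k) \<le> f x"
  using sum_le_suminf[of "\<lambda>k. fps_nth F k * x ^ k" "{..<n}"] sums_fps[of x] nonneg
  by (auto simp: sums_iff)

lemma taylor1_le_fps: "x \<in> {0<..<r} \<Longrightarrow> taylor1 n f 0 x \<le> f x"
  using partial_sum_le_fps[of x "Suc n"] by (simp add: taylor1_fps lessThan_Suc_atMost)

lemma taylor1_mono_fps:
  "0 \<le> x \<Longrightarrow> m \<le> n \<Longrightarrow> taylor1 m f 0 x \<le> taylor1 n f 0 x"
  unfolding taylor1_fps using nonneg by (intro sum_mono2) auto

lemma le_taylor2_fps:
  assumes c: "c \<in> {0<..<r}" and x: "x \<in> {0<..<c}"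
  shows "f x \<le> taylor2 n f 0 c x"
proof -
  let ?a = "fps_nth F"
  have "(\<lambda>k. ?a (k + n) * x ^ (k + n)) sums (f x - (\<Sum>k<n. ?a k * x ^ k))"
    using sums_split_initial_segment[OF sums_fps[of x]] x c by simp
  moreover have "(\<lambda>k. ?a (k + n) * c ^ (k + n) * (x / c) ^ n) sums
      ((f c - (\<Sum>k<n. ?a k * c ^ k)) * (x / c) ^ n)"
    using sums_split_initial_segment[OF sums_fps[OF c]] by (rule sums_mult2)
  moreover have "?a (k + n) * x ^ (k + n) \<le> ?a (k + n) * c ^ (k + n) * (x / c) ^ n" for k
  proof -
    \<comment> \<open>Since \<open>c ^ (k + n) * (x / c) ^ n\<close> equals
      \<open>c ^ k * x ^ n\<close>, the two tails differ only in \<open>x ^ k\<close> against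
      \<open>c ^ k\<close>.\<close>
    have "x ^ k * x ^ n \<le> c ^ k * x ^ n"
      using x by (intro mult_right_mono power_mono) auto
    then show ?thesis
      using x nonneg[of "k + n"]
      by (auto simp: power_add power_divide mult.assoc intro!: mult_left_mono)
  qed
  ultimately have "f x - (\<Sum>k<n. ?a k * x ^ k) \<le> (f c - (\<Sum>k<n. ?a k * c ^ k)) * (x / c) ^ n"
    by (rule sums_le[rotated])
  then show ?thesis
    by (simp add: taylor2_fps[OF c])
qed

lemma taylor2_Suc_le_fps:
  assumes c: "c \<in> {0<..<r}" and x: "x \<in> {0<..<c}"
  shows "taylor2 (Suc n) f 0 c x \<le> taylor2 n f 0 c x"
proof -
  let ?a = "fps_nth F"
  define q where "q = x / c"
  define R where "R = f c - (\<Sum>k<Suc n. ?a k * c ^ k)"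
  have x_eq: "x = q * c" and q: "0 \<le> q" "q \<le> 1"
    using x by (auto simp: q_def)
  have "R * q ^ Suc n \<le> R * q ^ n"
    using q partial_sum_le_fps[OF c, of "Suc n"]
    by (intro mult_left_mono power_decreasing) (auto simp: R_def)
  \<comment> \<open>The term of order \<open>n\<close> in the remainder at \<open>c\<close>, scaled
    by \<open>q ^ n\<close>, is exactly the one at \<open>x\<close>. Splitting it off leaves both
    orders with the same sum and the same \<open>R\<close>, which is nonnegative, so only the power
    of \<open>q\<close> differs.\<close>
  moreover have "taylor2 n f 0 c x = (\<Sum>k<Suc n. ?a k * x ^ k) + R * q ^ n"
    by (simp add: taylor2_fps[OF c] R_def flip: q_def)
       (simp add: x_eq power_mult_distrib algebra_simps)
  moreover have "taylor2 (Suc n) f 0 c x = (\<Sum>k<Suc n. ?a k * x ^ k) + R * q ^ Suc n"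
    by (simp only: taylor2_fps[OF c] R_def q_def)
  ultimately show ?thesis
    by simp
qed

end

end

section \<open>The secant series\<close>

definition fps_sec :: "'a :: field_char_0 \<Rightarrow> 'a fps"
  where "fps_sec c = inverse (fps_cos c)"

lemma fps_sec_nth_0 [simp]: "fps_nth (fps_sec c) 0 = 1"
  by (simp add: fps_sec_def)

lemma fps_sec_times_cos: "fps_sec c * fps_cos c = 1"
  unfolding fps_sec_def by (rule inverse_mult_eq_1) simp

lemma fps_tan_conv_sec: "fps_tan c = fps_sin c * fps_sec c"
  by (simp add: fps_tan_def fps_sec_def fps_divide_unit)

text \<open>This equation and the one for the tangent express the derivatives through secant and
  tangent without minus signs. Comparing coefficients gives recurrences that preserve nonnegativity
  when \<open>c\<close> is nonnegative.\<close>

lemma fps_deriv_sec: "fps_deriv (fps_sec c) = fps_const c * (fps_sec c * fps_tan c)"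
  by (simp add: fps_tan_conv_sec fps_sec_def fps_inverse_deriv fps_cos_deriv power2_eq_square
      algebra_simps flip: fps_const_neg)

lemma fps_deriv_tan: "fps_deriv (fps_tan c) = fps_const c * (1 + fps_tan c * fps_tan c)"
proof -
  have "fps_deriv (fps_tan c) =
      fps_const c * (fps_cos c * fps_sec c + fps_sin c * fps_sec c * (fps_sin c * fps_sec c))"
    by (simp add: fps_tan_conv_sec fps_deriv_sec fps_sin_deriv algebra_simps)
  then show ?thesis
    by (simp add: fps_tan_conv_sec fps_sec_times_cos mult.commute[of "fps_cos c"])
qed

lemma fps_sec_nth_Suc:
  "of_nat (Suc n) * fps_nth (fps_sec c) (Suc n) =
    c * (\<Sum>i=0..n. fps_nth (fps_sec c) i * fps_nth (fps_tan c) (n - i))"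
  using arg_cong[OF fps_deriv_sec[of c], of "\<lambda>F. fps_nth F n"]
  by (simp add: fps_mult_nth[of "fps_sec c"])

lemma fps_tan_nth_0 [simp]: "fps_nth (fps_tan c) 0 = 0"
  by (simp add: fps_tan_conv_sec)

lemma fps_tan_nth_1: "fps_nth (fps_tan c) 1 = c"
  using arg_cong[OF fps_deriv_tan[of c], of "\<lambda>F. fps_nth F 0"] by (simp add: fps_mult_nth)

lemma fps_tan_nth_nonneg:
  fixes c :: real
  assumes "c \<ge> 0"
  shows "fps_nth (fps_tan c) n \<ge> 0"
proof (induction n rule: less_induct)
  case (less n)
  show ?case
  proof (cases n)
    case (Suc m)
    have "real (Suc m) * fps_nth (fps_tan c) (Suc m) =
        c * (fps_nth 1 m + (\<Sum>i=0..m. fps_nth (fps_tan c) i * fps_nth (fps_tan c) (m - i)))"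
      using arg_cong[OF fps_deriv_tan[of c], of "\<lambda>F. fps_nth F m"]
      by (simp add: fps_mult_nth[of "fps_tan c"])
    also have "\<dots> \<ge> 0"
      using assms less Suc by (intro mult_nonneg_nonneg add_nonneg_nonneg sum_nonneg) auto
    finally show ?thesis
      using Suc by (simp add: zero_le_mult_iff)
  qed simp
qed

lemma fps_sec_nth_nonneg:
  fixes c :: real
  assumes "c \<ge> 0"
  shows "fps_nth (fps_sec c) n \<ge> 0"
proof (induction n rule: less_induct)
  case (less n)
  show ?case
  proof (cases n)
    case (Suc m)
    have "real (Suc m) * fps_nth (fps_sec c) (Suc m) \<ge> 0"
      unfolding fps_sec_nth_Suc using assms less Suc fps_tan_nth_nonneg[OF assms]
      by (intro mult_nonneg_nonneg sum_nonneg) auto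
    then show ?thesis
      using Suc by (simp add: zero_le_mult_iff)
  qed simp
qed

lemma fps_sec_nth_2: "fps_nth (fps_sec c) 2 = c\<^sup>2 / 2"
  using fps_sec_nth_Suc[of 1 c] fps_tan_nth_1[of c]
  by (simp add: numeral_2_eq_2 power2_eq_square field_simps)

text \<open>Keeps only the summand with the linear coefficient of the tangent.\<close>

lemma fps_sec_nth_step:
  fixes c :: real
  assumes "c \<ge> 0"
  shows "real (n + 2) * fps_nth (fps_sec c) (n + 2) \<ge> c\<^sup>2 * fps_nth (fps_sec c) n"
proof -
  have "fps_nth (fps_sec c) n * fps_nth (fps_tan c) (Suc n - n) \<le>
      (\<Sum>i=0..Suc n. fps_nth (fps_sec c) i * fps_nth (fps_tan c) (Suc n - i))"
    using fps_sec_nth_nonneg[OF assms] fps_tan_nth_nonneg[OF assms]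
    by (intro member_le_sum) auto
  then have "c * (fps_nth (fps_sec c) n * c) \<le> real (Suc (Suc n)) * fps_nth (fps_sec c) (Suc (Suc n))"
    unfolding fps_sec_nth_Suc using assms fps_tan_nth_1[of c] by (intro mult_left_mono) auto
  then show ?thesis
    by (simp add: power2_eq_square mult_ac)
qed

text \<open>A step of two divides the lower bound by \<open>2 * k + 2\<close> only, whereas the
  factorial grows by \<open>(2 * k + 1) * (2 * k + 2)\<close>. The surplus \<open>2 * k + 1\<close>
  is dropped in the induction and kept once, in the second bound, to beat the factor 2 of the
  cosine.\<close>

lemma fps_sec_nth_even_ge:
  fixes c :: real
  assumes "c \<ge> 0"
  shows "fps_nth (fps_sec c) (2 * k) \<ge> c ^ (2 * k) / fact (2 * k)"
    and "fps_nth (fps_sec c) (2 * k + 2) \<ge> real (2 * k + 1) * c ^ (2 * k + 2) / fact (2 * k + 2)"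
proof -
  have step: "fps_nth (fps_sec c) (2 * k + 2) \<ge> real (2 * k + 1) * c ^ (2 * k + 2) / fact (2 * k + 2)"
    if "fps_nth (fps_sec c) (2 * k) \<ge> c ^ (2 * k) / fact (2 * k)" for k
  proof -
    have "real (2 * k + 1) * c ^ (2 * k + 2) / fact (2 * k + 2) =
        c\<^sup>2 * (c ^ (2 * k) / fact (2 * k)) / real (2 * k + 2)"
      by (simp add: power2_eq_square divide_simps)
    also have "\<dots> \<le> c\<^sup>2 * fps_nth (fps_sec c) (2 * k) / real (2 * k + 2)"
      using that by (intro divide_right_mono mult_left_mono) auto
    also have "\<dots> \<le> fps_nth (fps_sec c) (2 * k + 2)"
      using fps_sec_nth_step[OF assms, of "2 * k"] by (simp add: field_simps)
    finally show ?thesis .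
  qed
  show "fps_nth (fps_sec c) (2 * k) \<ge> c ^ (2 * k) / fact (2 * k)"
  proof (induction k)
    case (Suc k)
    have "1 * c ^ (2 * k + 2) \<le> real (2 * k + 1) * c ^ (2 * k + 2)"
      using assms by (intro mult_right_mono) auto
    then have "c ^ (2 * k + 2) / fact (2 * k + 2) \<le> real (2 * k + 1) * c ^ (2 * k + 2) / fact (2 * k + 2)"
      by (intro divide_right_mono) (simp_all only: mult_1 fact_ge_zero)
    with step[OF Suc] show ?case
      by simp
  qed simp
  then show "fps_nth (fps_sec c) (2 * k + 2) \<ge> real (2 * k + 1) * c ^ (2 * k + 2) / fact (2 * k + 2)"
    by (rule step)
qed

text \<open>The zeros of the cosine that bound the radius of convergence are located in the complex plane.\<close>

lemma fps_conv_radius_sec: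
  fixes c :: real
  assumes "c > 0"
  shows "fps_conv_radius (fps_sec c) \<ge> pi / (2 * c)"
proof -
  \<comment> \<open>Over the complex numbers a zero-free disc bounds the radius of a reciprocal from
    below; over the reals it would not, as 1 / (1 + x^2) shows. Radii depend only on norms of
    coefficients, which carries the bound back.\<close>
  let ?S = "Abs_fps (\<lambda>n. of_real (fps_nth (fps_sec c) n)) :: complex fps"
  have "?S * fps_cos (of_real c) = Abs_fps (\<lambda>n. of_real (fps_nth (fps_sec c * fps_cos c) n))"
    by (rule fps_ext) (simp add: fps_mult_nth fps_cos_def if_distrib cong: if_cong)
  also have "\<dots> = 1"
    by (rule fps_ext) (simp add: fps_sec_times_cos)
  finally have S: "?S = inverse (fps_cos (of_real c))"
    by (metis fps_inverse_unique mult.commute)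
  have "min (pi / (2 * c)) (fps_conv_radius (fps_cos (of_real c :: complex)))
      \<le> fps_conv_radius (inverse (fps_cos (of_real c :: complex)))"
  proof (rule fps_conv_radius_inverse)
    fix z :: complex
    assume "ereal (norm z) < ereal (pi / (2 * c))"
    then have "norm (of_real c * z) < pi / 2"
      using assms by (simp add: norm_mult field_simps)
    then show "eval_fps (fps_cos (of_real c)) z \<noteq> 0"
      using cos_eq_zero_imp_norm_ge[of "of_real c * z"] by auto
  qed
  then have "pi / (2 * c) \<le> fps_conv_radius ?S"
    unfolding S by simp
  also have "fps_conv_radius ?S = fps_conv_radius (Abs_fps (\<lambda>n. norm (fps_nth ?S n)))"
    by (rule fps_conv_radius_norm [symmetric])
  also have "\<dots> = fps_conv_radius (Abs_fps (\<lambda>n. norm (fps_nth (fps_sec c) n)))"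
    by (simp only: fps_nth_Abs_fps norm_of_real real_norm_def)
  also have "\<dots> = fps_conv_radius (fps_sec c)"
    by (rule fps_conv_radius_norm)
  finally show ?thesis .
qed

lemma eval_fps_sec:
  fixes c :: real
  assumes "c > 0" "\<bar>x\<bar> < pi / (2 * c)"
  shows "eval_fps (fps_sec c) x = 1 / cos (c * x)"
proof -
  have "ereal (norm x) < fps_conv_radius (fps_sec c)"
    using assms by (intro norm_less_fps_conv_radius[OF fps_conv_radius_sec])
  \<comment> \<open>The product being 1 also shows that the cosine does not vanish here.\<close>
  then have "eval_fps (fps_sec c) x * cos (c * x) = 1"
    using eval_fps_mult[of x "fps_sec c" "fps_cos c"] by (simp add: fps_sec_times_cos)
  then show ?thesis
    by (metis mult_zero_right nonzero_eq_divide_eq zero_neq_one)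
qed

section \<open>The power series of the function\<close>

text \<open>The series of \<open>x ^ 2 * f x\<close>; the division by \<open>x ^ 2\<close> becomes
  an index shift in the final proof.\<close>

definition numer_fps :: "real fps"
  where "numer_fps = 1 - fps_const 2 * fps_cos (1 / 2) + fps_sec (1 / 2)"

lemma numer_fps_nth_0_1 [simp]: "fps_nth numer_fps 0 = 0" "fps_nth numer_fps (Suc 0) = 0"
  using fps_sec_nth_Suc[of 0 "1 / 2 :: real"] by (simp_all add: numer_fps_def fps_cos_def)

text \<open>The cosine contributes -2 times -1/8, the secant 1/8.\<close>

lemma numer_fps_nth_2: "fps_nth numer_fps 2 = 3 / 8"
  by (simp add: numer_fps_def fps_cos_def fps_sec_nth_2 power2_eq_square)

lemma numer_fps_nth_nonneg: "fps_nth numer_fps n \<ge> 0"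
\<comment> \<open>Index 2 is treated by its value because the secant bound has surplus factor only 1
  there. At odd indices the cosine contributes nothing.\<close>
proof (cases "n < 3 \<or> odd n")
  case True
  moreover have "n = 0 \<or> n = Suc 0 \<or> n = 2 \<or> n > 2"
    by arith
  ultimately consider "n = 0" | "n = Suc 0" | "n = 2" | "odd n" "n > 2"
    by auto
  then show ?thesis
  proof cases
    case 4
    then show ?thesis
      using fps_sec_nth_nonneg[of "1 / 2" n] by (simp add: numer_fps_def fps_cos_def)
  qed (simp_all add: numer_fps_nth_2)
next
  case False
  then obtain l where "n = 2 * l" "l \<ge> 2"
    by (auto elim!: evenE)
  \<comment> \<open>With \<open>k\<close> at least 1 the surplus factor \<open>2 * k + 1\<close> is
    at least 3, more than the 2 required.\<close>
  then obtain k where n: "n = 2 * k + 2" and k: "k \<ge> 1"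
    using that[of "l - 1"] by auto
  have "2 * ((1 / 2) ^ n / fact n) \<le> real (2 * k + 1) * (1 / 2) ^ n / fact n"
    using k by (simp add: divide_simps)
  also have "\<dots> \<le> fps_nth (fps_sec (1 / 2)) n"
    using fps_sec_nth_even_ge(2)[of "1 / 2" k] n by simp
  finally have ge: "2 * ((1 / 2) ^ n / fact n) \<le> fps_nth (fps_sec (1 / 2 :: real)) n" .
  have "fps_nth (fps_cos (1 / 2)) n \<le> (1 / 2 :: real) ^ n / fact n"
    by (cases "even (n div 2)") (simp_all add: fps_cos_def divide_simps)
  moreover have "fps_nth numer_fps n = fps_nth (fps_sec (1 / 2)) n - 2 * fps_nth (fps_cos (1 / 2)) n"
    using n by (simp add: numer_fps_def)
  ultimately show ?thesis
    using ge by linarith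
qed

text \<open>The cosine part is entire, so the secant alone sets the bound,
  \<open>pi / (2 * (1 / 2))\<close>.\<close>

lemma fps_conv_radius_numer: "fps_conv_radius numer_fps \<ge> pi"
proof -
  have "ereal pi \<le> fps_conv_radius (fps_sec (1 / 2 :: real))"
    using fps_conv_radius_sec[of "1 / 2"] by simp
  moreover have "fps_conv_radius (1 - fps_const 2 * fps_cos (1 / 2 :: real)) = \<infinity>"
    using fps_conv_radius_diff[of 1 "fps_const 2 * fps_cos (1 / 2 :: real)"]
    by (simp add: fps_conv_radius_cmult_left)
  ultimately have "ereal pi \<le> min (fps_conv_radius (1 - fps_const 2 * fps_cos (1 / 2 :: real)))
      (fps_conv_radius (fps_sec (1 / 2 :: real)))"
    by simp
  also have "\<dots> \<le> fps_conv_radius numer_fps"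
    unfolding numer_fps_def by (rule fps_conv_radius_add)
  finally show ?thesis .
qed

lemma eval_numer_fps:
  assumes "\<bar>x\<bar> < pi"
  shows "eval_fps numer_fps x = 1 - cos x / cos (x / 2)"
proof -
  have sec: "ereal (norm x) < fps_conv_radius (fps_sec (1 / 2 :: real))"
    using assms by (intro norm_less_fps_conv_radius[OF fps_conv_radius_sec]) auto
  have C: "fps_conv_radius (fps_const 2 * fps_cos (1 / 2 :: real)) = \<infinity>"
    by (simp add: fps_conv_radius_cmult_left)
  have D: "fps_conv_radius (1 - fps_const 2 * fps_cos (1 / 2 :: real)) = \<infinity>"
    using fps_conv_radius_diff[of 1 "fps_const 2 * fps_cos (1 / 2 :: real)"] C by simp
  have "eval_fps numer_fps x = 1 - 2 * cos (x / 2) + 1 / cos (x / 2)"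
    using assms sec unfolding numer_fps_def
    by (simp add: eval_fps_add eval_fps_diff eval_fps_mult eval_fps_sec C D)
  moreover have "cos (x / 2) > 0"
    using assms by (intro cos_gt_zero_pi) auto
  moreover have "cos x = 2 * (cos (x / 2))\<^sup>2 - 1"
    using cos_double_cos[of "x / 2"] by simp
  ultimately show ?thesis
    by (simp add: field_simps power2_eq_square)
qed

theorem theorem3:
  fixes f :: "real \<Rightarrow> real" and c :: real
  assumes f_0: "f 0 = 3 / 8"
    and f_eq: "\<And>x. x \<in> {0<..<pi} \<Longrightarrow> f x = (1 - cos x / cos (x / 2)) / x ^ 2"
    and c: "c \<in> {0<..<pi}"
  shows "(\<forall>n. right_taylor_data f 0 c n) \<and> (\<exists>l. (f \<longlongrightarrow> l) (at_left c)) \<and>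
    (\<forall>x\<in>{0<..<c}. \<forall>m n :: nat.
      taylor1 0 f 0 x = 3 / 8 \<and>
      taylor1 (2 * n) f 0 x \<le> taylor1 (2 * n + 2) f 0 x \<and>
      taylor1 (2 * n) f 0 x \<le> f x \<and>
      f x \<le> taylor2 (2 * m) f 0 c x \<and>
      taylor2 (2 * m + 2) f 0 c x \<le> taylor2 (2 * m) f 0 c x \<and>
      taylor2 0 f 0 c x = (1 - cos c / cos (c / 2)) / c ^ 2)"
proof -
  define F where "F = fps_shift 2 numer_fps"
  have r: "0 < pi" "ereal pi \<le> fps_conv_radius F"
    using fps_conv_radius_numer by (simp_all add: F_def)
  have f: "\<forall>x\<in>{0<..<pi}. f x = eval_fps F x"
  proof
    fix x :: real
    assume x: "x \<in> {0<..<pi}"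
    \<comment> \<open>The double zero at 0 ensures that shifting by 2 loses no coefficient and so
      amounts to dividing by \<open>x ^ 2\<close>.\<close>
    have "2 \<le> subdegree numer_fps"
      using numer_fps_nth_2
      by (intro subdegree_geI) (auto simp: less_2_cases_iff)
    moreover have "ereal (norm x) < fps_conv_radius numer_fps"
      using x by (intro norm_less_fps_conv_radius[OF fps_conv_radius_numer]) auto
    ultimately have "eval_fps F x = eval_fps numer_fps x / x ^ 2"
      using x by (simp add: F_def eval_fps_shift)
    then show "f x = eval_fps F x"
      using x by (simp add: f_eq eval_numer_fps)
  qed
  have nonneg: "fps_nth F k \<ge> 0" for k
    by (simp add: F_def numer_fps_nth_nonneg)
  note data = r f
  have "taylor1 0 f 0 x = 3 / 8" for x
    using numer_fps_nth_2 by (simp add: taylor1_fps[OF data] F_def numeral_2_eq_2)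
  moreover have "taylor2 0 f 0 c x = (1 - cos c / cos (c / 2)) / c ^ 2" for x
    by (simp add: taylor2_fps[OF data c] f_eq[OF c])
  moreover have "taylor2 (2 * m + 2) f 0 c x \<le> taylor2 (2 * m) f 0 c x"
    if "x \<in> {0<..<c}" for x m
    \<comment> \<open>The second approximations decrease at every order, so passing to the next even
      order is two single steps.\<close>
    using taylor2_Suc_le_fps[OF data nonneg c that, of "2 * m"]
      taylor2_Suc_le_fps[OF data nonneg c that, of "Suc (2 * m)"] by simp
  moreover have "taylor1 (2 * n) f 0 x \<le> f x" if "x \<in> {0<..<c}" for x n
    using taylor1_le_fps[OF data nonneg] that c by auto
  ultimately show ?thesis
    using right_taylor_data_fps[OF data] tendsto_at_left_fps[OF data c]
      le_taylor2_fps[OF data nonneg c] taylor1_mono_fps[OF data nonneg] c by auto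
qed

end
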